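(* Let $(N,v,\Gamma)$ be an organisational situation with $\Gamma=(N,A)$, let $(i_0,j_0)\in A$, and let $\Gamma^{-i_0j_0}=(N,A\setminus\{(i_0,j_0)\})$. Then for every $k\in N$ whose local digraphs in $\Gamma$ and in $\Gamma^{-i_0j_0}$ coincide, i.e. $\Gamma(k)=\Gamma^{-i_0j_0}(k)$, one has $$AF_k(N,v,\Gamma)=AF_k(N,v,\Gamma^{-i_0j_0}).$$
   Context: Let $N=\{1,\dots,n\}$, $n\ge 2$. A TU game on $N$ is a function $v:2^N\to\mathbb{R}$ with $v(\emptyset)=0$; it is superadditive if $v(S\cup Q)\ge v(S)+v(Q)$ for all disjoint $S,Q\subseteq N$. A digraph $\Gamma=(N,A)$ on $N$ has arc set $A\subseteq\{(i,j)\mid i,j\in N,\ i\ne j\}$. A circuit is a directed cycle (of length at least 2). Connectedness and connected components of a digraph are understood in the weak sense (arc directions ignored). If there is a directed path from $i$ to $j$ (with at least one arc), $j$ is a successor of $i$ and $i$ is a predecessor of $j$; if $(i,j)\in A$, they are immediate successor/predecessor. $S^\Gamma(i)$ and $\widehat S^\Gamma(i)$ denote the sets of successors and immediate successors of $i$, $\bar S^\Gamma(i)=S^\Gamma(i)\cup\{i\}$, and $\widehat P^\Gamma(i)$ is the set of immediate predecessors of $i$; for $X\subseteq N$, $\widehat P^\Gamma(X)=\bigcup_{x\in X}\widehat P^\Gamma(x)$. An arborescence is a weakly connected circuit-free digraph having a unique root (a node from which every other node is reachable by a directed path) such that the directed path from the root to any other node is unique (a single node is an arborescence). A forest is a digraph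 whose connected components are arborescences. A spanning forest of $\Gamma=(N,A)$ is a forest $(N,A')$ with $A'\subseteq A$; it is maximal if adding to it any other arc of $A$ does not give a forest. $\mathcal{F}^\Gamma$ denotes the set of maximal spanning forests of $\Gamma$. An organisational situation $(N,v,\Gamma)$ consists of a superadditive game $v$ on $N$ and a circuit-free digraph $\Gamma$ on $N$. For $F\in\mathcal{F}^\Gamma$ and $i\in N$ set $$m_i^{(v,\Gamma)}(F)=v(\bar S^F(i))-\sum_{j\in\widehat S^F(i)}v(\bar S^F(j)).$$ The average forest measure is $$AF_i(N,v,\Gamma)=\frac{1}{|\mathcal{F}^\Gamma|}\sum_{F\in\mathcal{F}^\Gamma}m_i^{(v,\Gamma)}(F),\qquad i\in N.$$ For a circuit-free digraph $\Gamma=(N,A)$ and $k\in N$, the local digraph $\Gamma(k)$ associated to $k$ has vertex set $\bar S^\Gamma(k)\cup\widehat P^\Gamma(S^\Gamma(k))$ and arc set $$\{(i,j)\in A\mid i,j\in\bar S^\Gamma(k)\}\ \cup\ \{(i,j)\in A\mid i\in\widehat P^\Gamma(S^\Gamma(k)),\ j\in S^\Gamma(k)\}.$$ *)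

theory Defs
  imports Complex_Main "Graph_Theory.Graph_Theory"
begin

text \<open>
  Digraphs on a set of nodes without parallel arcs are the pair digraphs of
  \<^theory>\<open>Graph_Theory.Pair_Digraph\<close>; weak connectedness, subgraphs, directed paths
  and cycles are the notions of the Graph_Theory entry.
\<close>

definition superadditive_game :: "'a set \<Rightarrow> ('a set \<Rightarrow> real) \<Rightarrow> bool" where
  "superadditive_game N v \<longleftrightarrow> v {} = 0 \<and>
     (\<forall>S Q. S \<subseteq> N \<and> Q \<subseteq> N \<and> S \<inter> Q = {} \<longrightarrow> v (S \<union> Q) \<ge> v S + v Q)"

text \<open>
  The constant \<^const>\<open>pre_digraph.cycle\<close> also counts loops, so for loop-free digraphs
  the following excludes exactly the directed cycles of length at least 2.
\<close>

definition circuit_free :: "('a, 'b) pre_digraph \<Rightarrow> bool" where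
  "circuit_free G \<longleftrightarrow> \<not> (\<exists>p. pre_digraph.cycle G p)"

definition is_root :: "('a, 'b) pre_digraph \<Rightarrow> 'a \<Rightarrow> bool" where
  "is_root G r \<longleftrightarrow> r \<in> verts G \<and> (\<forall>w \<in> verts G. r \<rightarrow>\<^sup>*\<^bsub>G\<^esub> w)"

definition arborescence :: "('a, 'b) pre_digraph \<Rightarrow> bool" where
  "arborescence G \<longleftrightarrow>
     Digraph_Component.connected G \<and> circuit_free G \<and> (\<exists>!r. is_root G r) \<and>
     (\<forall>r w. is_root G r \<and> w \<in> verts G \<longrightarrow> (\<exists>!p. pre_digraph.apath G r p w))"

text \<open>
  The constant \<^const>\<open>Digraph_Component.forest\<close> only forbids directed cycles,
  whence a notion of its own. Weak components are the maximal weakly connected subgraphs.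
\<close>

definition arborescence_forest :: "('a, 'b) pre_digraph \<Rightarrow> bool" where
  "arborescence_forest G \<longleftrightarrow>
     (\<forall>H. pre_digraph.max_subgraph G Digraph_Component.connected H \<longrightarrow> arborescence H)"

definition max_spanning_forests :: "'a pair_pre_digraph \<Rightarrow> 'a pair_pre_digraph set" where
  "max_spanning_forests G =
     {F. spanning (with_proj F) (with_proj G) \<and> arborescence_forest (with_proj F) \<and>
         (\<forall>a \<in> parcs G - parcs F.
            \<not> arborescence_forest (with_proj (F\<lparr>parcs := insert a (parcs F)\<rparr>)))}"

definition succs :: "'a pair_pre_digraph \<Rightarrow> 'a \<Rightarrow> 'a set" where
  "succs G i = {j. i \<rightarrow>\<^sup>+\<^bsub>with_proj G\<^esub> j}"

definition imm_succs :: "'a pair_pre_digraph \<Rightarrow> 'a \<Rightarrow> 'a set" where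
  "imm_succs G i = {j. (i, j) \<in> parcs G}"

definition succs_refl :: "'a pair_pre_digraph \<Rightarrow> 'a \<Rightarrow> 'a set" where
  "succs_refl G i = succs G i \<union> {i}"

definition imm_preds :: "'a pair_pre_digraph \<Rightarrow> 'a \<Rightarrow> 'a set" where
  "imm_preds G i = {j. (j, i) \<in> parcs G}"

definition imm_preds_set :: "'a pair_pre_digraph \<Rightarrow> 'a set \<Rightarrow> 'a set" where
  "imm_preds_set G X = (\<Union>x \<in> X. imm_preds G x)"

definition organisational_situation ::
    "'a set \<Rightarrow> ('a set \<Rightarrow> real) \<Rightarrow> 'a pair_pre_digraph \<Rightarrow> bool" where
  "organisational_situation N v G \<longleftrightarrow>
     superadditive_game N v \<and> pair_digraph G \<and> pverts G = N \<and> circuit_free (with_proj G)"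

definition forest_contribution :: "('a set \<Rightarrow> real) \<Rightarrow> 'a pair_pre_digraph \<Rightarrow> 'a \<Rightarrow> real" where
  "forest_contribution v F i = v (succs_refl F i) - (\<Sum>j \<in> imm_succs F i. v (succs_refl F j))"

text \<open>The player set is \<^term>\<open>pverts G\<close>, so it is not a separate argument.\<close>

definition average_forest_measure ::
    "('a set \<Rightarrow> real) \<Rightarrow> 'a pair_pre_digraph \<Rightarrow> 'a \<Rightarrow> real" where
  "average_forest_measure v G i =
     1 / real (card (max_spanning_forests G)) *
     (\<Sum>F \<in> max_spanning_forests G. forest_contribution v F i)"

definition local_digraph :: "'a pair_pre_digraph \<Rightarrow> 'a \<Rightarrow> 'a pair_pre_digraph" where
  "local_digraph G k =
     \<lparr> pverts = succs_refl G k \<union> imm_preds_set G (succs G k),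
       parcs = {(i, j) \<in> parcs G. i \<in> succs_refl G k \<and> j \<in> succs_refl G k} \<union>
               {(i, j) \<in> parcs G. i \<in> imm_preds_set G (succs G k) \<and> j \<in> succs G k} \<rparr>"

definition delete_arc :: "'a pair_pre_digraph \<Rightarrow> 'a \<times> 'a \<Rightarrow> 'a pair_pre_digraph" where
  "delete_arc G a = G\<lparr>parcs := parcs G - {a}\<rparr>"

end

theory Submission
  imports Defs
begin

text \<open>
  In a circuit-free digraph the spanning forests are exactly the arc sets with at most one arc
  into each node, and the maximal ones choose exactly one arc into each node that has
  predecessors. The choices at different nodes are independent. The contribution of \<open>k\<close> to a
  forest only depends on the choices at the successors of \<open>k\<close>, so for a node \<open>j\<close> that
  is not a successor of \<open>k\<close> deleting all arcs into \<open>j\<close> preserves the average.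
  Equality of the local digraphs forces \<open>j\<^sub>0\<close> to be such a node, and \<open>\<Gamma>\<close> and
  \<open>\<Gamma>\<close> without \<open>(i\<^sub>0, j\<^sub>0)\<close> agree once all arcs into \<open>j\<^sub>0\<close> are deleted.
\<close>

section \<open>Walks, paths and roots in acyclic digraphs\<close>

lemma (in wf_digraph) circuit_free_iff_acyclic:
  "circuit_free G \<longleftrightarrow> acyclic (arcs_ends G)"
proof -
  \<comment> \<open>A nonempty closed walk contains a cycle, and a cycle is itself such a
    walk.\<close>
  have "(\<exists>p. cycle p) \<longleftrightarrow> (\<exists>u. u \<rightarrow>\<^sup>+ u)"
    unfolding reachable1_awalk using closed_w_imp_cycle
    by (metis closed_w_def cycle_altdef length_greater_0_conv)
  then show ?thesis
    by (simp add: circuit_free_def acyclic_def)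
qed

lemma (in wf_digraph) acyclic_closed_awalk_eq_Nil:
  assumes "acyclic (arcs_ends G)" "awalk u p u"
  shows "p = []"
  using assms reachable1_awalkI by (metis acyclic_def)

lemma (in wf_digraph) acyclic_awalk_imp_apath:
  assumes "acyclic (arcs_ends G)" "awalk u p w"
  shows "apath u p w"
proof (rule ccontr)
  assume "\<not> apath u p w"
  then have "\<not> distinct (awalk_verts u p)"
    using assms(2) by (simp add: apath_def)
  then obtain r x where "closed_w r" "awalk x r x"
    using awalk_not_distinct_decomp[OF assms(2)] closed_w_def by blast
  then show False
    using acyclic_closed_awalk_eq_Nil[OF assms(1)] by (auto simp: closed_w_def)
qed

text \<open>Walks are compared from their ends: the end node determines the last arc because
  \<open>head\<close> is injective, and acyclicity prevents one walk from being empty while the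
  other is not.\<close>

lemma (in wf_digraph) inj_head_awalk_unique:
  assumes ac: "acyclic (arcs_ends G)" and inj: "inj_on (head G) (arcs G)"
  shows "awalk u p w \<Longrightarrow> awalk u q w \<Longrightarrow> p = q"
proof (induction p arbitrary: w q rule: rev_induct)
  case Nil
  then show ?case
    using acyclic_closed_awalk_eq_Nil[OF ac] by (auto simp: awalk_Nil_iff)
next
  case (snoc e p)
  have "q \<noteq> []"
    using snoc.prems acyclic_closed_awalk_eq_Nil[OF ac] awalk_Nil_iff
    by (metis append_is_Nil_conv not_Cons_self2)
  then obtain q' e' where q: "q = q' @ [e']"
    by (metis rev_exhaust)
  have "e \<in> arcs G" "head G e = w" "awalk u p (tail G e)"
    "e' \<in> arcs G" "head G e' = w" "awalk u q' (tail G e')"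
    using snoc.prems unfolding q by (auto simp: awalk_Cons_iff awalk_Nil_iff)
  then show ?case
    using inj snoc.IH q by (metis inj_onD)
qed

lemma (in wf_digraph) inj_head_connected_reachable:
  assumes inj: "inj_on (head G) (arcs G)" and conn: "connected G"
    and r: "r \<in> verts G" "\<And>e. e \<in> arcs G \<Longrightarrow> head G e \<noteq> r" and w: "w \<in> verts G"
  shows "r \<rightarrow>\<^sup>* w"
proof -
  have "r \<rightarrow>\<^sup>*\<^bsub>mk_symmetric G\<^esub> w"
    using conn r(1) w by (auto simp: connected_def strongly_connected_def)
  then have "(r, w) \<in> (parcs (mk_symmetric G))\<^sup>*"
    unfolding reachable_def by (metis rtrancl_on_rtranclI with_proj_simps(3))
  then show ?thesis
  proof induction
    case base
    show ?case using r(1) by simp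
  next
    case (step y z)
    from step.hyps(2) consider
        (forward) e where "e \<in> arcs G" "tail G e = y" "head G e = z"
      | (backward) e where "e \<in> arcs G" "head G e = y" "tail G e = z"
      by (auto simp: parcs_mk_symmetric)
    then show ?case
    proof cases
      case forward
      then show ?thesis
        using step.IH by (metis reachable_adj_trans in_arcs_imp_in_arcs_ends)
    next
      case backward
      obtain p where p: "awalk r p y"
        using step.IH reachable_awalk by auto
      \<comment> \<open>The node \<open>y\<close> has an incoming arc, hence differs from the source
        \<open>r\<close>.\<close>
      have "p \<noteq> []"
        using p backward(2) r(2)[OF backward(1)] by (auto simp: awalk_Nil_iff)
      then obtain p' e' where "p = p' @ [e']"
        by (metis rev_exhaust)
      then have "awalk r p' (tail G e')" "e' \<in> arcs G" "head G e' = y"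
        using p by (auto simp: awalk_Cons_iff awalk_Nil_iff)
      then show ?thesis
        using backward inj by (metis inj_onD reachable_awalkI)
    qed
  qed
qed

text \<open>Finiteness and acyclicity make the arc relation well-founded. A minimal node has no
  incoming arc and therefore reaches all others; a second root would lie on a closed walk with
  it.\<close>

lemma (in fin_digraph) arborescenceI:
  assumes conn: "connected G" and ac: "acyclic (arcs_ends G)"
    and inj: "inj_on (head G) (arcs G)"
  shows "arborescence G"
proof -
  have "finite (arcs_ends G)"
    by (simp add: arcs_ends_def)
  then have "wf (arcs_ends G)"
    using ac by (rule finite_acyclic_wf)
  moreover obtain x where "x \<in> verts G"
    using conn by (auto simp: connected_def strongly_connected_def)
  ultimately obtain r where r: "r \<in> verts G" "\<And>y. (y, r) \<in> arcs_ends G \<Longrightarrow> y \<notin> verts G"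
    by (metis wfE_min)
  then have "head G e \<noteq> r" if "e \<in> arcs G" for e
    using that by (metis in_arcs_imp_in_arcs_ends tail_in_verts)
  then have root: "is_root G r"
    using r(1) inj_head_connected_reachable[OF inj conn] by (auto simp: is_root_def)
  moreover have "s = r" if "is_root G s" for s
  proof (rule ccontr)
    assume "s \<noteq> r"
    then have "s \<rightarrow>\<^sup>+ r" "r \<rightarrow>\<^sup>+ s"
      using that root by (auto simp: is_root_def)
    then show False
      using ac by (meson acyclic_def trancl_trans)
  qed
  moreover have "\<exists>!p. apath s p w" if "is_root G s" "w \<in> verts G" for s w
    using that reachable_apath inj_head_awalk_unique[OF ac inj] awalkI_apath
    by (metis is_root_def)
  ultimately show ?thesis
    using conn ac circuit_free_iff_acyclic unfolding arborescence_def by blast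
qed

text \<open>Two arcs with a common head extend walks from the root to walks ending in that head. By
  acyclicity these are paths, so uniqueness of the path identifies their last arcs.\<close>

lemma (in wf_digraph) arborescence_imp_inj_head:
  assumes "arborescence G"
  shows "inj_on (head G) (arcs G)"
proof (rule inj_onI)
  fix e e' assume e: "e \<in> arcs G" "e' \<in> arcs G" "head G e = head G e'"
  have ac: "acyclic (arcs_ends G)"
    using assms by (simp add: arborescence_def circuit_free_iff_acyclic)
  obtain r where r: "is_root G r"
    using assms by (auto simp: arborescence_def)
  have "\<exists>p. apath r (p @ [a]) (head G a)" if a: "a \<in> arcs G" for a
  proof -
    obtain p where "awalk r p (tail G a)"
      using r a tail_in_verts reachable_awalk unfolding is_root_def by blast
    then have "awalk r (p @ [a]) (head G a)"
      using a by (auto simp: awalk_Cons_iff awalk_Nil_iff)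
    then show ?thesis
      using acyclic_awalk_imp_apath[OF ac] by blast
  qed
  then obtain p p' where "apath r (p @ [e]) (head G e)" "apath r (p' @ [e']) (head G e)"
    using e by metis
  moreover have "\<exists>!p. apath r p (head G e)"
    using assms r e by (auto simp: arborescence_def)
  ultimately show "e = e'"
    by (metis last_snoc)
qed

section \<open>Forests as digraphs with at most one arc into each node\<close>

lemma (in fin_digraph) ex_max_subgraph:
  assumes "subgraph H G" "P H"
  obtains K where "max_subgraph P K" "subgraph H K"
proof -
  \<comment> \<open>An extremal choice: between \<open>H\<close> and \<open>G\<close>, a subgraph
    with property \<open>P\<close> and the most nodes and arcs is maximal, since a proper
    enlargement with \<open>P\<close> would increase this count.\<close>
  let ?m = "\<lambda>K. card (verts K) + card (arcs K)"
  let ?Q = "\<lambda>K. subgraph H K \<and> subgraph K G \<and> P K"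
  have H: "?Q H"
    using assms by (auto intro: wf_digraph.subgraph_refl)
  have "?m K \<le> card (verts G) + card (arcs G)" if "?Q K" for K
    using that by (auto intro!: add_mono card_mono simp: subgraph_def)
  then obtain K where K: "?Q K" "\<And>L. ?Q L \<Longrightarrow> ?m L \<le> ?m K"
    using ex_has_greatest_nat[of ?Q H ?m "Suc (card (verts G) + card (arcs G))"] H
    by (metis less_Suc_eq_le)
  have "max_subgraph P K"
    unfolding max_subgraph_def
  proof (intro conjI allI impI notI)
    fix L assume L: "L \<noteq> K \<and> subgraph K L" "subgraph L G \<and> P L"
    then have le: "?m L \<le> ?m K"
      using K subgraph_trans by blast
    have sub: "verts K \<subseteq> verts L" "arcs K \<subseteq> arcs L"
      and fin: "finite (verts L)" "finite (arcs L)"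
      using L by (auto simp: subgraph_def intro: finite_subset)
    then have "card (verts K) \<le> card (verts L)" "card (arcs K) \<le> card (arcs L)"
      by (auto intro: card_mono)
    with le have "card (verts K) = card (verts L)" "card (arcs K) = card (arcs L)"
      by linarith+
    then have "verts K = verts L" "arcs K = arcs L"
      using sub fin by (simp_all add: card_subset_eq)
    moreover have "tail K = tail L" "head K = head L"
      using L by (auto simp: subgraph_def compatible_def)
    ultimately show False
      using L by simp
  qed (use K in auto)
  with K that show thesis
    by blast
qed

text \<open>This turns the condition on components into a condition on single arcs. Components
  inherit acyclicity and injectivity of \<open>head\<close>; conversely, two arcs with a common head
  lie in one component.\<close>

lemma (in fin_digraph) arborescence_forest_iff:
  assumes "circuit_free G"
  shows "arborescence_forest G \<longleftrightarrow> inj_on (head G) (arcs G)"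
proof
  assume inj: "inj_on (head G) (arcs G)"
  show "arborescence_forest G"
    unfolding arborescence_forest_def
  proof (intro allI impI)
    fix H assume "max_subgraph connected H"
    then have H: "subgraph H G" "connected H"
      by (auto simp: max_subgraph_def)
    interpret H: fin_digraph H
      using H(1) by (rule fin_digraph_subgraph)
    show "arborescence H"
    proof (rule H.arborescenceI)
      show "acyclic (arcs_ends H)"
        using assms arcs_ends_mono[OF H(1)] acyclic_subset circuit_free_iff_acyclic by blast
      show "inj_on (head H) (arcs H)"
        using H(1) inj by (auto simp: subgraph_def compatible_def intro: inj_on_subset)
    qed (fact H(2))
  qed
next
  assume forest: "arborescence_forest G"
  show "inj_on (head G) (arcs G)"
  proof (rule inj_onI)
    fix e e' assume e: "e \<in> arcs G" "e' \<in> arcs G" "head G e = head G e'"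
    \<comment> \<open>The subgraph formed by the two arcs is connected through their common head, so
      some component contains both arcs, and that component is an arborescence.\<close>
    define H where "H = \<lparr> verts = {tail G e, tail G e', head G e}, arcs = {e, e'},
      tail = tail G, head = head G \<rparr>"
    have H: "wf_digraph H"
      using e by unfold_locales (auto simp: H_def)
    then have sub: "subgraph H G"
      using e wf_digraph by (auto simp: H_def subgraph_def compatible_def)
    interpret S: pair_wf_digraph "mk_symmetric H"
      using wf_digraph.wellformed_mk_symmetric[OF H] .
    have j: "head G e \<rightarrow>\<^sup>*\<^bsub>mk_symmetric H\<^esub> w" "w \<rightarrow>\<^sup>*\<^bsub>mk_symmetric H\<^esub> head G e"
      if "w \<in> verts H" for w
    proof -
      have "w = head G e \<or>
          (head G e, w) \<in> parcs (mk_symmetric H) \<and> (w, head G e) \<in> parcs (mk_symmetric H)"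
        using that e(3) by (auto simp: H_def parcs_mk_symmetric)
      moreover have "w \<in> pverts (mk_symmetric H)"
        using that by simp
      ultimately show "head G e \<rightarrow>\<^sup>*\<^bsub>mk_symmetric H\<^esub> w" "w \<rightarrow>\<^sup>*\<^bsub>mk_symmetric H\<^esub> head G e"
        using S.reachable_adjI S.reachable_refl by blast+
    qed
    have "connected H"
      unfolding connected_def
    proof (rule strongly_connectedI)
      show "verts (with_proj (mk_symmetric H)) \<noteq> {}"
        by (simp add: H_def)
      show "u \<rightarrow>\<^sup>*\<^bsub>mk_symmetric H\<^esub> w"
        if "u \<in> verts (with_proj (mk_symmetric H))" "w \<in> verts (with_proj (mk_symmetric H))" for u w
        using that j S.reachable_trans[of u "head G e" w] by simp
    qed
    with sub obtain K where K: "max_subgraph connected K" "subgraph H K"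
      by (rule ex_max_subgraph)
    then have "arborescence K"
      using forest by (simp add: arborescence_forest_def)
    moreover have "wf_digraph K" "e \<in> arcs K" "e' \<in> arcs K" "head K = head G"
      using K(2) by (auto simp: subgraph_def compatible_def H_def)
    ultimately show "e = e'"
      using e(3) wf_digraph.arborescence_imp_inj_head by (metis inj_onD)
  qed
qed

section \<open>Maximal spanning forests as choices of one arc into each possible head\<close>

lemma (in pair_digraph) pair_digraph_parcs_subset:
  assumes "pverts H = pverts G" "parcs H \<subseteq> parcs G"
  shows "pair_digraph H"
proof
  show "fst e \<in> pverts H" "snd e \<in> pverts H" "fst e \<noteq> snd e" if "e \<in> parcs H" for e
    using that assms arc_fst_in_verts arc_snd_in_verts pair_no_loops by auto
  show "finite (pverts H)" "finite (parcs H)"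
    using assms(1) pair_finite_verts finite_subset[OF assms(2) pair_finite_arcs] by simp_all
qed

lemma (in pair_digraph) circuit_free_parcs_subset:
  assumes "circuit_free (with_proj G)" "pverts H = pverts G" "parcs H \<subseteq> parcs G"
  shows "circuit_free (with_proj H)"
proof -
  interpret H: pair_digraph H
    using assms(2,3) by (rule pair_digraph_parcs_subset)
  show ?thesis
    using assms(1,3) circuit_free_iff_acyclic H.circuit_free_iff_acyclic
    by (metis acyclic_subset)
qed

text \<open>The bijection combines two conditions: injectivity of \<open>snd\<close> says that the
  arcs form a forest, and surjectivity onto the heads of \<open>G\<close> says that it is
  maximal.\<close>

lemma (in pair_digraph) max_spanning_forests_eq:
  assumes "circuit_free (with_proj G)"
  shows "max_spanning_forests G =
    {F. pverts F = pverts G \<and> parcs F \<subseteq> parcs G \<and> bij_betw snd (parcs F) (snd ` parcs G)}"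
proof -
  have wf: "pair_wf_digraph F"
    and forest: "arborescence_forest (with_proj F) \<longleftrightarrow> inj_on snd (parcs F)"
    if F: "pverts F = pverts G" "parcs F \<subseteq> parcs G" for F
  proof -
    interpret F: pair_digraph F
      using F by (rule pair_digraph_parcs_subset)
    have "circuit_free (with_proj F)"
      using assms F by (rule circuit_free_parcs_subset)
    then show "arborescence_forest (with_proj F) \<longleftrightarrow> inj_on snd (parcs F)"
      using F.arborescence_forest_iff by simp
    show "pair_wf_digraph F" ..
  qed
  have span: "spanning (with_proj F) (with_proj G) \<longleftrightarrow> pverts F = pverts G \<and> parcs F \<subseteq> parcs G"
    for F
    using wf[of F] wf_digraph_wp_iff[of F] wf_digraph_wp_iff[of G] pair_wf_digraph
    by (auto simp: spanning_def subgraph_def)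
  have maximal: "(\<forall>a \<in> parcs G - parcs F.
      \<not> arborescence_forest (with_proj (F\<lparr>parcs := insert a (parcs F)\<rparr>)))
      \<longleftrightarrow> snd ` parcs F = snd ` parcs G"
    if F: "pverts F = pverts G" "parcs F \<subseteq> parcs G" "inj_on snd (parcs F)" for F
  proof -
    \<comment> \<open>An arc can be added to a forest exactly when its head has no incoming arc
      there.\<close>
    have "arborescence_forest (with_proj (F\<lparr>parcs := insert a (parcs F)\<rparr>))
        \<longleftrightarrow> snd a \<notin> snd ` parcs F" if "a \<in> parcs G - parcs F" for a
      using that F by (subst forest) auto
    then show ?thesis
      using image_mono[OF F(2), of snd] by blast
  qed
  show ?thesis
    unfolding max_spanning_forests_def bij_betw_def
  proof (rule Collect_cong)
    fix F
    show "spanning (with_proj F) (with_proj G) \<and> arborescence_forest (with_proj F) \<and>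
        (\<forall>a \<in> parcs G - parcs F.
          \<not> arborescence_forest (with_proj (F\<lparr>parcs := insert a (parcs F)\<rparr>))) \<longleftrightarrow>
      pverts F = pverts G \<and> parcs F \<subseteq> parcs G \<and> inj_on snd (parcs F) \<and>
        snd ` parcs F = snd ` parcs G"
      using span[of F] forest[of F] maximal[of F] by metis
  qed
qed

section \<open>Successors and contributions under insertion of an arc\<close>

lemma succs_mono:
  assumes "parcs F \<subseteq> parcs G"
  shows "succs F x \<subseteq> succs G x"
  using assms by (auto simp: succs_def dest: trancl_mono)

text \<open>A walk from \<open>x\<close> that uses the new arc passes through \<open>j\<close>,
  which is excluded; every other walk already exists in \<open>F\<close>.\<close>

lemma succs_insert_arc:
  assumes "j \<notin> succs (F\<lparr>parcs := insert (i, j) (parcs F)\<rparr>) x"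
  shows "succs (F\<lparr>parcs := insert (i, j) (parcs F)\<rparr>) x = succs F x"
proof
  let ?R = "insert (i, j) (parcs F)"
  have j: "(x, j) \<notin> ?R\<^sup>+"
    using assms by (simp add: succs_def)
  have "(x, y) \<in> (parcs F)\<^sup>+" if "(x, y) \<in> ?R\<^sup>+" for y
    using that
  proof induction
    case (base y)
    then have "y \<noteq> j"
      using j by auto
    then show ?case
      using base by auto
  next
    case (step y z)
    have "z \<noteq> j"
      using step.hyps j by (auto dest: trancl_into_trancl)
    then show ?case
      using step by (auto intro: trancl_into_trancl)
  qed
  then show "succs (F\<lparr>parcs := ?R\<rparr>) x \<subseteq> succs F x"
    by (auto simp: succs_def)
qed (rule succs_mono, auto)

text \<open>The contribution involves only the successor sets of \<open>k\<close> and of its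
  immediate successors. As \<open>j\<close> is a successor of none of these nodes, the new arc
  changes none of the sets.\<close>

lemma forest_contribution_insert_arc:
  assumes "j \<notin> succs (F\<lparr>parcs := insert (i, j) (parcs F)\<rparr>) k"
  shows "forest_contribution v (F\<lparr>parcs := insert (i, j) (parcs F)\<rparr>) k = forest_contribution v F k"
proof -
  let ?F = "F\<lparr>parcs := insert (i, j) (parcs F)\<rparr>"
  have imm: "imm_succs ?F k = imm_succs F k"
    using assms by (auto simp: imm_succs_def succs_def)
  have "succs_refl ?F x = succs_refl F x" if "x \<in> imm_succs ?F k" for x
  proof -
    have "j \<notin> succs ?F x"
      using that assms by (auto simp: succs_def imm_succs_def intro: trancl_into_trancl2)
    then show ?thesis
      using succs_insert_arc[where F = F and i = i and j = j and x = x]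
      by (simp add: succs_refl_def)
  qed
  then show ?thesis
    using imm succs_insert_arc[OF assms]
    unfolding forest_contribution_def succs_refl_def by simp
qed

section \<open>Separating the choice of the arc into one node\<close>

definition delete_in_arcs :: "'a pair_pre_digraph \<Rightarrow> 'a \<Rightarrow> 'a pair_pre_digraph" where
  "delete_in_arcs G j = G\<lparr>parcs := {a \<in> parcs G. snd a \<noteq> j}\<rparr>"

lemma delete_in_arcs_simps [simp]:
  "pverts (delete_in_arcs G j) = pverts G"
  "parcs (delete_in_arcs G j) = {a \<in> parcs G. snd a \<noteq> j}"
  by (simp_all add: delete_in_arcs_def)

text \<open>The arc into \<open>j\<close> is chosen independently of all others. A predecessor of
  \<open>j\<close> must exist, for otherwise the product is empty although \<open>G\<close> has
  maximal spanning forests.\<close>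

lemma (in pair_digraph) bij_betw_max_spanning_forests:
  assumes cf: "circuit_free (with_proj G)" and j: "imm_preds G j \<noteq> {}"
  shows "bij_betw (\<lambda>(F, i). F\<lparr>parcs := insert (i, j) (parcs F)\<rparr>)
    (max_spanning_forests (delete_in_arcs G j) \<times> imm_preds G j) (max_spanning_forests G)"
    (is "bij_betw ?f (?Y \<times> ?I) ?X")
proof -
  let ?D = "delete_in_arcs G j"
  interpret D: pair_digraph ?D
    by (rule pair_digraph_parcs_subset) auto
  have cfD: "circuit_free (with_proj ?D)"
    by (rule circuit_free_parcs_subset[OF cf]) auto
  have Y: "?Y = {F. pverts F = pverts G \<and> parcs F \<subseteq> parcs ?D \<and>
      bij_betw snd (parcs F) (snd ` parcs ?D)}"
    using D.max_spanning_forests_eq[OF cfD] by simp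
  note X = max_spanning_forests_eq[OF cf]
  have heads: "snd ` parcs G = insert j (snd ` parcs ?D)" "j \<notin> snd ` parcs ?D"
    using j by (force simp: imm_preds_def)+
  show ?thesis
  proof (rule bij_betwI)
    \<comment> \<open>The inverse splits off the arc into \<open>j\<close>. The description is
      proper because \<open>j\<close> is a head of \<open>G\<close>, so a maximal forest has exactly
      one arc into it.\<close>
    let ?g = "\<lambda>F. (delete_in_arcs F j, THE i. (i, j) \<in> parcs F)"
    show "?f \<in> ?Y \<times> ?I \<rightarrow> ?X"
    proof
      fix z assume "z \<in> ?Y \<times> ?I"
      then obtain F i where [simp]: "z = (F, i)" and F: "F \<in> ?Y" and i: "(i, j) \<in> parcs G"
        by (auto simp: imm_preds_def)
      have "bij_betw snd (insert (i, j) (parcs F)) (insert j (snd ` parcs ?D))"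
        using F heads(2) unfolding Y bij_betw_def by auto
      then show "?f z \<in> ?X"
        using F i unfolding X Y heads(1) by auto
    qed
    have The: "(THE i. (i, j) \<in> parcs F) = i"
      if "bij_betw snd (parcs F) (snd ` parcs G)" "(i, j) \<in> parcs F"
      for F :: "'a pair_pre_digraph" and i
    proof (rule the_equality)
      show "i' = i" if "(i', j) \<in> parcs F" for i'
        using inj_onD[OF bij_betw_imp_inj_on, OF \<open>bij_betw _ _ _\<close> _ that \<open>(i, j) \<in> _\<close>] by simp
    qed (fact that(2))
    have ex: "\<exists>i. (i, j) \<in> parcs F" if "bij_betw snd (parcs F) (snd ` parcs G)" for F :: "'a pair_pre_digraph"
    proof -
      have "j \<in> snd ` parcs F"
        using that heads(1) by (simp add: bij_betw_def)
      then show ?thesis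
        by auto
    qed
    show "?g \<in> ?X \<rightarrow> ?Y \<times> ?I"
    proof
      fix F assume F: "F \<in> ?X"
      then obtain i where i: "(i, j) \<in> parcs F" "(THE i. (i, j) \<in> parcs F) = i"
        using ex The X by blast
      have "snd ` {a \<in> parcs F. snd a \<noteq> j} = snd ` parcs F - {j}"
        by auto
      also have "\<dots> = snd ` parcs ?D"
        using F heads by (simp add: X bij_betw_def)
      finally have "bij_betw snd (parcs (delete_in_arcs F j)) (snd ` parcs ?D)"
        using F by (auto simp: X bij_betw_def intro: inj_on_subset)
      then show "?g F \<in> ?Y \<times> ?I"
        using F i by (auto simp: X Y imm_preds_def)
    qed
    show "?g (?f z) = z" if z: "z \<in> ?Y \<times> ?I" for z
    proof -
      obtain F i where [simp]: "z = (F, i)" and F: "parcs F \<subseteq> parcs ?D"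
        using z by (cases z) (auto simp: Y)
      have no_j: "(i', j) \<notin> parcs F" for i'
        using F by auto
      have "delete_in_arcs (?f z) j = F"
        using F by (auto simp: delete_in_arcs_def intro!: pair_pre_digraph.equality)
      moreover have "(THE i'. (i', j) \<in> parcs (?f z)) = i"
        using no_j by simp
      ultimately show ?thesis
        by simp
    qed
    show "?f (?g F) = F" if F: "F \<in> ?X" for F
    proof -
      obtain i where i: "(i, j) \<in> parcs F" "(THE i. (i, j) \<in> parcs F) = i"
        using F ex The X by blast
      have "a = (i, j)" if "a \<in> parcs F" "snd a = j" for a
        using F that i(1) inj_onD[of snd "parcs F" a "(i, j)"] by (simp add: X bij_betw_def)
      then have "insert (i, j) {a \<in> parcs F. snd a \<noteq> j} = parcs F"
        using i(1) by blast
      then show ?thesis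
        using i by simp
    qed
  qed
qed

text \<open>Each maximal forest of the reduced digraph arises from \<open>card ?I\<close> maximal
  forests of \<open>G\<close>, all with the same contribution of \<open>k\<close>. This factor
  multiplies both the sum and the number of forests and cancels.\<close>

lemma (in pair_digraph) average_forest_measure_delete_in_arcs:
  assumes cf: "circuit_free (with_proj G)" and j: "j \<notin> succs G k"
  shows "average_forest_measure v G k = average_forest_measure v (delete_in_arcs G j) k"
proof (cases "imm_preds G j = {}")
  case True
  then have "delete_in_arcs G j = G"
    by (auto simp: imm_preds_def intro!: pair_pre_digraph.equality)
  then show ?thesis
    by simp
next
  case False
  let ?X = "max_spanning_forests G" and ?Y = "max_spanning_forests (delete_in_arcs G j)"
  let ?I = "imm_preds G j" and ?f = "\<lambda>(F, i). F\<lparr>parcs := insert (i, j) (parcs F)\<rparr>"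
  note bij = bij_betw_max_spanning_forests[OF cf False]
  have "?I \<subseteq> fst ` parcs G"
    by (force simp: imm_preds_def)
  then have "finite ?I"
    using pair_finite_arcs finite_surj by blast
  then have pos: "card ?I > 0"
    using False by (simp add: card_gt_0_iff)
  have contrib: "forest_contribution v (?f z) k = forest_contribution v (fst z) k"
    if "z \<in> ?Y \<times> ?I" for z
  proof -
    obtain F i where [simp]: "z = (F, i)"
      by (cases z)
    have "?f z \<in> ?X"
      using bij_betwE[OF bij] that by blast
    \<comment> \<open>The hypothesis on \<open>j\<close> concerns \<open>G\<close>; it passes to the
      extended forest because that is a subgraph of \<open>G\<close>.\<close>
    then have "parcs (?f z) \<subseteq> parcs G"
      by (simp add: max_spanning_forests_eq[OF cf])
    then have "succs (?f z) k \<subseteq> succs G k"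
      by (rule succs_mono)
    then have "j \<notin> succs (?f z) k"
      using j by blast
    then show ?thesis
      using forest_contribution_insert_arc[where F = F and i = i] by simp
  qed
  have "(\<Sum>F\<in>?X. forest_contribution v F k) = (\<Sum>z\<in>?Y \<times> ?I. forest_contribution v (?f z) k)"
    by (rule sum.reindex_bij_betw[OF bij, symmetric])
  also have "\<dots> = (\<Sum>z\<in>?Y \<times> ?I. forest_contribution v (fst z) k)"
    by (rule sum.cong[OF refl contrib])
  also have "\<dots> = card ?I * (\<Sum>F\<in>?Y. forest_contribution v F k)"
    using sum.cartesian_product[of "\<lambda>F i. forest_contribution v F k" ?I ?Y]
    by (simp add: case_prod_unfold sum_distrib_left)
  finally have "(\<Sum>F\<in>?X. forest_contribution v F k) = card ?I * (\<Sum>F\<in>?Y. forest_contribution v F k)" .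
  moreover have "card ?X = card ?Y * card ?I"
    using bij_betw_same_card[OF bij] by (simp add: card_cartesian_product)
  ultimately show ?thesis
    using pos by (simp add: average_forest_measure_def)
qed

section \<open>From equal local digraphs to equal averages\<close>

lemma local_digraph_eq_delete_arc_imp_not_succ:
  assumes "(i, j) \<in> parcs G" "local_digraph G k = local_digraph (delete_arc G (i, j)) k"
  shows "j \<notin> succs G k"
proof
  assume "j \<in> succs G k"
  \<comment> \<open>Here \<open>i\<close> is an immediate predecessor of the successor
    \<open>j\<close>, so the second arc set of the local digraph contains \<open>(i, j)\<close>. The
    local digraph after the deletion has only surviving arcs.\<close>
  then have "(i, j) \<in> parcs (local_digraph G k)"
    using assms(1) by (auto simp: local_digraph_def imm_preds_set_def imm_preds_def)
  then show False
    unfolding assms(2) by (auto simp: local_digraph_def delete_arc_def)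
qed

theorem proposition3:
  fixes n :: nat
    and v :: "nat set \<Rightarrow> real"
    and \<Gamma> :: "nat pair_pre_digraph"
    and i\<^sub>0 j\<^sub>0 k :: nat
  assumes "n \<ge> 2"
    and "organisational_situation {1..n} v \<Gamma>"
    and "(i\<^sub>0, j\<^sub>0) \<in> parcs \<Gamma>"
    and "k \<in> {1..n}"
    and "local_digraph \<Gamma> k = local_digraph (delete_arc \<Gamma> (i\<^sub>0, j\<^sub>0)) k"
  shows "average_forest_measure v \<Gamma> k = average_forest_measure v (delete_arc \<Gamma> (i\<^sub>0, j\<^sub>0)) k"
proof -
  let ?H = "delete_arc \<Gamma> (i\<^sub>0, j\<^sub>0)"
  interpret pair_digraph \<Gamma>
    using assms(2) by (simp add: organisational_situation_def)
  have cf: "circuit_free (with_proj \<Gamma>)"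
    using assms(2) by (simp add: organisational_situation_def)
  have sub: "pverts ?H = pverts \<Gamma>" "parcs ?H \<subseteq> parcs \<Gamma>"
    by (auto simp: delete_arc_def)
  interpret H: pair_digraph ?H
    using sub by (rule pair_digraph_parcs_subset)
  have j: "j\<^sub>0 \<notin> succs \<Gamma> k"
    using assms(3,5) by (rule local_digraph_eq_delete_arc_imp_not_succ)
  then have jH: "j\<^sub>0 \<notin> succs ?H k"
    using succs_mono[OF sub(2)] by blast
  have "delete_in_arcs ?H j\<^sub>0 = delete_in_arcs \<Gamma> j\<^sub>0"
    by (auto simp: delete_arc_def intro!: pair_pre_digraph.equality)
  then show ?thesis
    using average_forest_measure_delete_in_arcs[OF cf j]
      H.average_forest_measure_delete_in_arcs[OF circuit_free_parcs_subset[OF cf sub] jH]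
    by simp
qed

end
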